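(* Let $\Omega\subset\mathbb{R}^N$ be a bounded domain and let $f$ be a Lipschitz continuous function. Assume that $u\in\mathcal{L}_s(\mathbb{R}^N)\cap C^{1,1}_{loc}(\Omega)\cap C(\overline\Omega)$ is a solution of $$\begin{cases}(-\Delta+m^2)^s u(x)=f(u(x)) & \text{in }\Omega,\\ u(x)=\varphi(x) & \text{on }\Omega^c,\end{cases}$$ and satisfies the following hypothesis: for any three points $x=(x',x_N)$, $y=(x',y_N)$, $z=(x',z_N)$ lying on a segment parallel to the $x_N$-axis with $y_N<x_N<z_N$ and $y,z\in\Omega^c$, one has $$\varphi(y)<u(x)<\varphi(z)\ \text{ if } x\in\Omega,\qquad\text{and}\qquad \varphi(y)\le\varphi(x)\le\varphi(z)\ \text{ if } x\in\Omega^c.$$ Then $u$ is monotone increasing with respect to $x_N$ in $\Omega$, i.e. for any $\tau>0$, $$u(x',x_N+\tau)>u(x',x_N)\qquad\text{for all }(x',x_N),\,(x',x_N+\tau)\in\Omega.$$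
   Context: Let $N\ge 1$ be an integer, $0<s<1$, $m>0$. Points are written $x=(x',x_N)$ with $x'\in\mathbb{R}^{N-1}$; $\Omega^c=\mathbb{R}^N\setminus\Omega$; $\varphi$ is a given function on $\Omega^c$. $K_\nu$ is the modified Bessel function of the second kind of order $\nu$, $K_\nu(r)=\int_0^\infty e^{-r\cosh t}\cosh(\nu t)\,dt$ for $r>0$. The operator $(-\Delta+m^2)^s$ is defined by $$(-\Delta+m^2)^s u(x)=c_{N,s}m^{\frac N2+s}\,\mathrm{P.V.}\int_{\mathbb{R}^N}\frac{u(x)-u(y)}{|x-y|^{\frac N2+s}}K_{\frac N2+s}(m|x-y|)\,dy+m^{2s}u(x),\qquad c_{N,s}=2^{1-\frac N2+s}\pi^{-\frac N2}\frac{s(1-s)}{\Gamma(2-s)},$$ where P.V. denotes the Cauchy principal value. The function space is $\mathcal{L}_s(\mathbb{R}^N)=\{u:\mathbb{R}^N\to\mathbb{R}\,:\,\int_{\mathbb{R}^N}\frac{e^{-|x|}|u(x)|}{1+|x|^{\frac{N+1}2+s}}dx<\infty\}$. $C^{1,1}_{loc}$ denotes $C^1$ functions with locally Lipschitz gradient. Convention: whenever the operator is applied to a function $u$, it is understood that $\int_{|y-x|\ge1}\frac{|u(y)|}{|x-y|^{N/2+s}}K_{\frac N2+s}(m|x-y|)\,dy<\infty$ for every $x\in\mathbb{R}^N$, so that $(-\Delta+m^2)^su$ is well defined where $u$ is locally $C^{1,1}$ (this is automatic for $u\in\mathcal{L}_s(\mathbb{R}^N)$ if $m\ge1$). *)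

theory Defs
  imports "HOL-Analysis.Analysis"
begin

definition bessel_K :: "real \<Rightarrow> real \<Rightarrow> real" where
  "bessel_K \<nu> r = (LINT t:{0..}|lborel. exp (- r * cosh t) * cosh (\<nu> * t))"

(* The factor |x - y|^(-N/2-s) K_(N/2+s)(m |x - y|) as a function of z = x - y, with
   N = CARD('n).  Its value at z = 0 is never used: principal values cut out y = x. *)
definition op_kernel :: "real \<Rightarrow> real \<Rightarrow> real ^ 'n \<Rightarrow> real" where
  "op_kernel m s z =
     bessel_K (real CARD('n) / 2 + s) (m * norm z) / norm z powr (real CARD('n) / 2 + s)"

definition op_const :: "nat \<Rightarrow> real \<Rightarrow> real" where
  "op_const N s = 2 powr (1 - real N / 2 + s) * pi powr (- (real N / 2))
                  * (s * (1 - s) / Gamma (2 - s))"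

(* The Cauchy principal value, at the singular point x, of the integral of g exists and
   equals I.  Integrability is required explicitly because the Bochner integral of a
   non-integrable function is 0. *)
definition has_principal_value :: "(real ^ 'n \<Rightarrow> real) \<Rightarrow> real ^ 'n \<Rightarrow> real \<Rightarrow> bool" where
  "has_principal_value g x I \<longleftrightarrow>
     (\<forall>\<epsilon>>0. set_integrable lebesgue {y. dist x y \<ge> \<epsilon>} g) \<and>
     ((\<lambda>\<epsilon>. LINT y:{y. dist x y \<ge> \<epsilon>}|lebesgue. g y) \<longlongrightarrow> I) (at_right 0)"

(* (-Laplacian + m^2)^s u is defined at x and has value v there. *)
definition has_rel_frac_laplacian ::
    "real \<Rightarrow> real \<Rightarrow> (real ^ 'n \<Rightarrow> real) \<Rightarrow> real ^ 'n \<Rightarrow> real \<Rightarrow> bool" where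
  "has_rel_frac_laplacian m s u x v \<longleftrightarrow>
     (\<exists>I. has_principal_value (\<lambda>y. (u x - u y) * op_kernel m s (x - y)) x I \<and>
          v = op_const CARD('n) s * m powr (real CARD('n) / 2 + s) * I + m powr (2 * s) * u x)"

(* The standing convention under which the operator is applied to u. *)
definition tail_integrable :: "real \<Rightarrow> real \<Rightarrow> (real ^ 'n \<Rightarrow> real) \<Rightarrow> bool" where
  "tail_integrable m s u \<longleftrightarrow>
     (\<forall>x. set_integrable lebesgue {y. dist x y \<ge> 1} (\<lambda>y. \<bar>u y\<bar> * op_kernel m s (x - y)))"

(* Measurability of u is stated separately: it does not follow from that of |u|. *)
definition L_space :: "real \<Rightarrow> (real ^ 'n \<Rightarrow> real) set" where
  "L_space s = {u. u \<in> borel_measurable lebesgue \<and>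
     integrable lebesgue (\<lambda>x. exp (- norm x) * \<bar>u x\<bar> /
                             (1 + norm x powr ((real CARD('n) + 1) / 2 + s)))}"

definition C11_loc :: "(real ^ 'n) set \<Rightarrow> (real ^ 'n \<Rightarrow> real) set" where
  "C11_loc \<Omega> = {u. \<exists>G. (\<forall>x\<in>\<Omega>. GDERIV u x :> G x) \<and>
     (\<forall>x\<in>\<Omega>. \<exists>r>0. \<exists>L. L-lipschitz_on (ball x r \<inter> \<Omega>) G)}"

end

theory Submission
  imports Defs "HOL-Real_Asymp.Real_Asymp"
begin

text \<open>
The proof is a sliding argument.  Write \<open>w x = u (x + \<tau> e) - u x\<close> with \<open>e\<close> the \<open>k\<close>-th unit vector
and \<open>\<tau> > 0\<close>.  Since \<open>\<Omega>\<close> is bounded, every line parallel to \<open>e\<close> leaves it at both ends, so the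
ordering hypothesis gives \<open>w x \<ge> 0\<close> unless \<open>x\<close> and \<open>x + \<tau> e\<close> both lie in \<open>\<Omega>\<close>, and strictly so when
exactly one of them does.  Where both do, subtracting the two equations bounds the operator
applied to \<open>w\<close> by \<open>L * \<bar>w x\<bar>\<close>, where \<open>L\<close> is the Lipschitz constant of \<open>f\<close>.

Two minimum principles then exclude a negative minimum and an interior contact point.  Both
rest on positivity of the kernel; the first also uses its singularity of order
\<open>\<bar>z\<bar> powr (- N - 2 * s)\<close> at \<open>0\<close>.  If the set where \<open>w\<close> may be negative has small measure, a
negative minimum makes the operator too negative
(\<open>small_volume_minimum_principle\<close>).  If \<open>w \<ge> 0\<close> everywhere and \<open>w > 0\<close> on some nonempty open set,
then \<open>w\<close> has no zero at a point of \<open>\<Omega>\<close> that is shifted into \<open>\<Omega>\<close>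
(\<open>strong_maximum_principle_at_minimum\<close>).  Such an open set always exists: the part of \<open>\<Omega>\<close> within
distance \<open>\<tau>\<close> of its top.

The first principle yields a fixed compact \<open>K \<subseteq> \<Omega>\<close> such that for every \<open>\<tau>\<close> with a violation
\<open>w x < 0\<close> there is one with both \<open>x\<close> and \<open>x + \<tau> e\<close> in \<open>K\<close> (\<open>negative_shift_meets_compact_core\<close>).
If some \<open>\<tau>\<close> had a violation, then among all shifts \<open>\<tau>' \<ge> \<tau>\<close> with a point of \<open>K\<close> that satisfies \<open>w x \<le> 0\<close>
and is shifted into \<open>K\<close> there would be a largest one, by compactness.  All larger shifts have no
violation, so by continuity neither has this one; but it has a contact point, which the
second principle forbids.  Hence \<open>w \<ge> 0\<close> for every \<open>\<tau>\<close>, and once more the second principle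
makes the inequality strict.
\<close>

section \<open>Translation, subtraction and one-sided bounds for principal values\<close>

lemma
  fixes g :: "'a::euclidean_space \<Rightarrow> real"
  shows integrable_lebesgue_translation: "integrable lebesgue g \<Longrightarrow> integrable lebesgue (\<lambda>y. g (h + y))"
    and lebesgue_integral_translation: "integrable lebesgue g \<Longrightarrow> (LINT y|lebesgue. g (h + y)) = (LINT y|lebesgue. g y)"
proof -
  assume g: "integrable lebesgue g"
  let ?T = "\<lambda>y::'a. h + y"
  have T: "(\<lambda>y. h + (\<Sum>j\<in>Basis. (1 * (y \<bullet> j)) *\<^sub>R j)) = ?T"
    by (simp add: euclidean_representation)
  have m: "?T \<in> lebesgue \<rightarrow>\<^sub>M lebesgue"
    using lebesgue_affine_measurable[of "\<lambda>_. 1" h] unfolding T by simp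
  have d: "lebesgue = distr lebesgue lebesgue ?T"
    using lebesgue_affine_euclidean[of "\<lambda>_. 1" h] unfolding T
    by (simp add: density_1)
  have i: "integrable (distr lebesgue lebesgue ?T) g"
    using g d by metis
  show "integrable lebesgue (\<lambda>y. g (h + y))"
    by (rule integrable_distr[OF m i])
  have "(LINT y|distr lebesgue lebesgue ?T. g y) = (LINT y|lebesgue. g (h + y))"
    by (rule integral_distr[OF m]) (use g in simp)
  then show "(LINT y|lebesgue. g (h + y)) = (LINT y|lebesgue. g y)"
    using d by metis
qed

text \<open>
The truncated domain \<open>{y. dist x y \<ge> \<epsilon>}\<close> moves with its centre, so each truncated integral is
preserved exactly and no limit has to be exchanged.
\<close>

lemma has_principal_value_translation:
  fixes g :: "real ^ 'n \<Rightarrow> real"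
  assumes "has_principal_value g (x + h) I"
  shows "has_principal_value (\<lambda>y. g (y + h)) x I"
proof -
  let ?g = "\<lambda>e y. indicator {y. dist (x + h) y \<ge> e} y *\<^sub>R g y"
  have shift: "indicator {y. dist x y \<ge> e} y *\<^sub>R g (y + h) = ?g e (h + y)" for e y
    by (auto simp: indicator_def dist_norm algebra_simps)
  show ?thesis
    unfolding has_principal_value_def
  proof safe
    have int: "integrable lebesgue (?g e)" if "e > 0" for e
      using assms that by (simp add: has_principal_value_def set_integrable_def)
    show "set_integrable lebesgue {y. dist x y \<ge> e} (\<lambda>y. g (y + h))" if "e > 0" for e
      unfolding set_integrable_def shift by (rule integrable_lebesgue_translation[OF int[OF that]])
    have ev: "\<forall>\<^sub>F e in at_right 0. (LINT y:{y. dist (x + h) y \<ge> e}|lebesgue. g y)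
        = (LINT y:{y. dist x y \<ge> e}|lebesgue. g (y + h))"
      using eventually_at_right_less[of 0]
    proof eventually_elim
      case (elim e)
      then show ?case
        unfolding set_lebesgue_integral_def shift
        by (rule lebesgue_integral_translation[OF int, symmetric])
    qed
    show "((\<lambda>e. LINT y:{y. dist x y \<ge> e}|lebesgue. g (y + h)) \<longlongrightarrow> I) (at_right 0)"
      by (rule Lim_transform_eventually[OF _ ev])
         (use assms in \<open>auto simp: has_principal_value_def\<close>)
  qed
qed

lemma has_principal_value_diff:
  assumes "has_principal_value g x I" and "has_principal_value h x J"
  shows "has_principal_value (\<lambda>y. g y - h y) x (I - J)"
  unfolding has_principal_value_def
proof safe
  show "set_integrable lebesgue {y. dist x y \<ge> e} (\<lambda>y. g y - h y)" if "e > 0" for e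
    using assms that by (auto simp: has_principal_value_def)
  have ev: "\<forall>\<^sub>F e in at_right (0::real). (LINT y:{y. dist x y \<ge> e}|lebesgue. g y)
        - (LINT y:{y. dist x y \<ge> e}|lebesgue. h y) = (LINT y:{y. dist x y \<ge> e}|lebesgue. g y - h y)"
    using eventually_at_right_less[of 0]
  proof eventually_elim
    case (elim e)
    then show ?case using assms by (auto simp: has_principal_value_def set_integral_diff)
  qed
  show "((\<lambda>e. LINT y:{y. dist x y \<ge> e}|lebesgue. g y - h y) \<longlongrightarrow> I - J) (at_right 0)"
    by (rule Lim_transform_eventually[OF tendsto_diff ev])
       (use assms in \<open>auto simp: has_principal_value_def\<close>)
qed

lemma has_rel_frac_laplacian_translation:
  assumes "has_rel_frac_laplacian m s u (x + h) v"
  shows "has_rel_frac_laplacian m s (\<lambda>y. u (y + h)) x v"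
  using assms has_principal_value_translation[where x=x and h=h]
  unfolding has_rel_frac_laplacian_def by fastforce

lemma has_rel_frac_laplacian_diff:
  assumes "has_rel_frac_laplacian m s u x a" and "has_rel_frac_laplacian m s v x b"
  shows "has_rel_frac_laplacian m s (\<lambda>y. u y - v y) x (a - b)"
proof -
  obtain I J where *: "has_principal_value (\<lambda>y. (u x - u y) * op_kernel m s (x - y)) x I"
      "has_principal_value (\<lambda>y. (v x - v y) * op_kernel m s (x - y)) x J"
      "a = op_const CARD('a) s * m powr (real CARD('a) / 2 + s) * I + m powr (2 * s) * u x"
      "b = op_const CARD('a) s * m powr (real CARD('a) / 2 + s) * J + m powr (2 * s) * v x"
    using assms unfolding has_rel_frac_laplacian_def by blast
  show ?thesis unfolding has_rel_frac_laplacian_def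
    by (rule exI[of _ "I - J"])
       (use has_principal_value_diff[OF *(1,2)] *(3,4) in \<open>auto simp: algebra_simps\<close>)
qed

text \<open>
For an integrand that is nonpositive away from the singularity, discarding part of the domain
only increases the integral.  Hence a single region at positive distance from \<open>x\<close> bounds all
truncated integrals with small \<open>\<epsilon>\<close>, and therefore their limit, whatever cancellation happens
near \<open>x\<close>.
\<close>

lemma principal_value_le_integral:
  assumes pv: "has_principal_value g x I" and nonpos: "\<And>y. y \<noteq> x \<Longrightarrow> g y \<le> 0"
    and A: "A \<in> sets lebesgue" and r: "0 < r" and far: "A \<subseteq> {y. dist x y \<ge> r}"
  shows "set_integrable lebesgue A g" and "I \<le> (LINT y:A|lebesgue. g y)"
proof -
  have int: "set_integrable lebesgue {y. dist x y \<ge> e} g" if "e > 0" for e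
    using pv that by (auto simp: has_principal_value_def)
  show intA: "set_integrable lebesgue A g"
    by (rule set_integrable_subset[OF int[OF r] A far])
  have "\<forall>\<^sub>F e in at_right 0. (LINT y:{y. dist x y \<ge> e}|lebesgue. g y) \<le> (LINT y:A|lebesgue. g y)"
    using eventually_at_right_less[of 0] eventually_at_rightI[of 0 r "\<lambda>e. e < r", OF _ r, simplified]
  proof eventually_elim
    case (elim e)
    show ?case
      using int[OF elim(1)] intA unfolding set_integrable_def set_lebesgue_integral_def
    proof (rule integral_mono)
      fix y
      show "indicator {y. e \<le> dist x y} y *\<^sub>R g y \<le> indicator A y *\<^sub>R g y"
        using nonpos[of y] far elim by (cases "y = x") (auto split: split_indicator)
    qed
  qed
  then show "I \<le> (LINT y:A|lebesgue. g y)"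
    by (rule tendsto_upperbound[rotated]) (use pv in \<open>auto simp: has_principal_value_def\<close>)
qed

section \<open>Lower bounds for the Bessel kernel\<close>

text \<open>
Integrability has to be established before any lower bound, since the Bochner integral of a
non-integrable function is \<open>0\<close>.  The quadratic growth of \<open>cosh t\<close> in the exponent dominates the
factor \<open>cosh (\<nu> * t) \<le> exp (\<bar>\<nu>\<bar> * t)\<close> and leaves a decay of \<open>exp (- t)\<close>.
\<close>

lemma bessel_K_integrable:
  fixes r \<nu> :: real
  assumes r: "0 < r"
  shows "set_integrable lborel {0..} (\<lambda>t. exp (- r * cosh t) * cosh (\<nu> * t))"
proof -
  have "set_integrable lebesgue {0..} (\<lambda>t::real. exp (- t))"
    using integrable_on_exp_minus_to_infinity[of 1 0]
    by (intro nonnegative_absolutely_integrable_1) auto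
  moreover have "(\<lambda>t::real. indicator {0..} t *\<^sub>R exp (- t)) \<in> borel_measurable lborel"
    by measurable
  ultimately have e: "set_integrable lborel {0..} (\<lambda>t::real. exp (- t))"
    unfolding set_integrable_def by (simp add: integrable_completion)
  define a where "a = \<bar>\<nu>\<bar> + 1"
  let ?C = "exp (a\<^sup>2 / r)"
  show ?thesis
  proof (rule set_integrable_bound[OF set_integrable_mult_right[of ?C, OF e]])
    show "set_borel_measurable lborel {0..} (\<lambda>t. exp (- r * cosh t) * cosh (\<nu> * t))"
      unfolding set_borel_measurable_def cosh_def by measurable
    have "exp (- r * cosh t) * cosh (\<nu> * t) \<le> ?C * exp (- t)" if t: "0 \<le> t" for t
    proof -
      have "1 + t + t\<^sup>2/2 \<le> exp t" using exp_lower_Taylor_quadratic[OF t] by simp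
      moreover have "1 + -t \<le> exp (-t)" using exp_ge_add_one_self[of "-t"] by simp
      ultimately have "t\<^sup>2 / 4 \<le> cosh t" by (simp add: cosh_def)
      then have "r * (t\<^sup>2 / 4) \<le> r * cosh t" using r by simp
      \<comment> \<open>completing the square in the exponent\<close>
      moreover have "0 \<le> (r * t / 2 - a)\<^sup>2 / r" using r by simp
      then have "a * t \<le> r * (t\<^sup>2 / 4) + a\<^sup>2 / r"
        using r by (simp add: field_simps power2_eq_square)
      ultimately have "- r * cosh t + \<bar>\<nu>\<bar> * t \<le> a\<^sup>2 / r - t"
        unfolding a_def by (simp add: algebra_simps)
      then have 1: "exp (- r * cosh t) * exp (\<bar>\<nu>\<bar> * t) \<le> ?C * exp (- t)"
        unfolding exp_add[symmetric] by simp
      have "cosh (\<nu> * t) = cosh (\<bar>\<nu>\<bar> * t)" by (simp add: abs_if)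
      also have "exp (- (\<bar>\<nu>\<bar> * t)) \<le> exp (\<bar>\<nu>\<bar> * t)" using t by simp
      then have "cosh (\<bar>\<nu>\<bar> * t) \<le> exp (\<bar>\<nu>\<bar> * t)"
        by (simp add: cosh_def)
      finally have "exp (- r * cosh t) * cosh (\<nu> * t) \<le> exp (- r * cosh t) * exp (\<bar>\<nu>\<bar> * t)"
        by (intro mult_left_mono) auto
      with 1 show ?thesis by linarith
    qed
    then show "AE x in lborel. x \<in> {0..} \<longrightarrow> norm (exp (- r * cosh x) * cosh (\<nu> * x)) \<le> norm (?C * exp (- x))"
      by (auto simp: cosh_real_nonneg abs_mult)
  qed
qed

text \<open>
The integrand is positive, so the integral is at least its part over \<open>{a..a + 1}\<close>; there the
first factor is smallest at the right end and the second at the left end.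
\<close>

lemma bessel_K_ge:
  assumes r: "0 < r" and a: "0 \<le> a" and \<nu>: "0 \<le> \<nu>"
  shows "exp (- r * cosh (a + 1)) * cosh (\<nu> * a) \<le> bessel_K \<nu> r"
proof -
  have i: "set_integrable lborel {a..a+1} (\<lambda>t. c)" for c :: real
    unfolding set_integrable_def by (intro integrable_scaleR_left integrable_real_indicator) auto
  have I: "set_integrable lborel {a..a+1} (\<lambda>t. exp (- r * cosh t) * cosh (\<nu> * t))"
    by (rule set_integrable_subset[OF bessel_K_integrable[OF r]]) (use a in auto)
  have "exp (- r * cosh (a + 1)) * cosh (\<nu> * a)
      = (LINT t:{a..a+1}|lborel. exp (- r * cosh (a + 1)) * cosh (\<nu> * a))"
    by (simp add: set_lebesgue_integral_def)
  also have "\<dots> \<le> (LINT t:{a..a+1}|lborel. exp (- r * cosh t) * cosh (\<nu> * t))"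
    using i I
  proof (rule set_integral_mono)
    fix t assume "t \<in> {a..a + 1}"
    then show "exp (- r * cosh (a + 1)) * cosh (\<nu> * a) \<le> exp (- r * cosh t) * cosh (\<nu> * t)"
      using r a \<nu> by (intro mult_mono) (auto simp: cosh_real_nonneg_le_iff mult_left_mono)
  qed
  also have "\<dots> \<le> bessel_K \<nu> r"
    unfolding bessel_K_def set_lebesgue_integral_def
    by (rule integral_mono)
       (use I bessel_K_integrable[OF r] a in
         \<open>auto simp: set_integrable_def cosh_real_nonneg split: split_indicator\<close>)
  finally show ?thesis .
qed

lemma bessel_K_pos:
  assumes "0 < r" and "0 \<le> \<nu>"
  shows "0 < bessel_K \<nu> r"
  using bessel_K_ge[OF assms(1) order.refl assms(2)]
  by (rule less_le_trans[rotated]) simp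

text \<open>
This is the singularity of the Bessel function at \<open>0\<close>, with a non-optimal constant.  The window
\<open>{a..a + 1}\<close> is placed at \<open>a = - ln r\<close>, where \<open>exp (- r * cosh t)\<close> is still bounded below while
\<open>cosh (\<nu> * t)\<close> has already reached the size \<open>r powr (- \<nu>)\<close>.
\<close>

lemma bessel_K_ge_powr:
  assumes r: "0 < r" "r \<le> 1" and \<nu>: "0 \<le> \<nu>"
  shows "exp (- exp 1) / 2 * r powr (- \<nu>) \<le> bessel_K \<nu> r"
proof -
  define a where "a = - ln r"
  have a: "0 \<le> a" using r by (simp add: a_def)
  have "exp (- (a + 1)) \<le> exp (a + 1)" using a by simp
  then have "cosh (a + 1) \<le> exp (a + 1)" by (simp add: cosh_def)
  also have "\<dots> = exp 1 / r" using r by (simp add: a_def exp_diff)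
  finally have 1: "exp (- exp 1) \<le> exp (- r * cosh (a + 1))"
    using r by (simp add: field_simps)
  have 2: "r powr (- \<nu>) / 2 \<le> cosh (\<nu> * a)"
    using r by (simp add: a_def powr_def cosh_def mult.commute)
  have "exp (- exp 1) / 2 * r powr (- \<nu>) = exp (- exp 1) * (r powr (- \<nu>) / 2)" by simp
  also have "\<dots> \<le> exp (- r * cosh (a + 1)) * cosh (\<nu> * a)"
    using 1 2 by (intro mult_mono) auto
  also have "\<dots> \<le> bessel_K \<nu> r" by (rule bessel_K_ge[OF r(1) a \<nu>])
  finally show ?thesis .
qed

lemma op_kernel_pos:
  fixes z :: "real ^ 'n"
  assumes "0 < s" "0 < m" "z \<noteq> 0"
  shows "0 < op_kernel m s z"
  using assms by (auto simp: op_kernel_def intro!: divide_pos_pos bessel_K_pos)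

text \<open>
The bound is uniform on a ball of radius \<open>R\<close> and of order \<open>R powr (- N - 2 * s)\<close>, a factor
\<open>R powr (- 2 * s)\<close> larger than the reciprocal of the volume of that ball.
\<close>

lemma op_kernel_ge:
  fixes z :: "real ^ 'n"
  assumes s: "0 < s" and m: "0 < m" and z: "z \<noteq> 0" "norm z \<le> R" and R: "m * R \<le> 1"
  defines "\<nu> \<equiv> real CARD('n) / 2 + s"
  shows "exp (- exp 1) / 2 * m powr (- \<nu>) * R powr (- (2 * \<nu>)) \<le> op_kernel m s z"
proof -
  have \<nu>: "0 \<le> \<nu>" using s by (simp add: \<nu>_def)
  have nz: "0 < norm z" using z by simp
  have le: "m * norm z \<le> 1" using mult_left_mono[OF z(2), of m] m R by linarith
  have "R powr (- (2 * \<nu>)) \<le> norm z powr (- (2 * \<nu>))"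
    using nz z(2) \<nu> by (intro powr_mono2') auto
  then have "exp (- exp 1) / 2 * m powr (- \<nu>) * R powr (- (2 * \<nu>))
      \<le> exp (- exp 1) / 2 * m powr (- \<nu>) * norm z powr (- (2 * \<nu>))"
    by (intro mult_left_mono) auto
  also have "norm z powr (- (2 * \<nu>)) = norm z powr (- \<nu>) / norm z powr \<nu>"
    using nz by (simp add: powr_diff[symmetric])
  also have "exp (- exp 1) / 2 * m powr (- \<nu>) * \<dots>
      = exp (- exp 1) / 2 * (m * norm z) powr (- \<nu>) / norm z powr \<nu>"
    using m nz by (simp add: powr_mult)
  also have "\<dots> \<le> op_kernel m s z"
    unfolding op_kernel_def \<nu>_def[symmetric]
    by (rule divide_right_mono[OF bessel_K_ge_powr[OF _ le \<nu>]]) (use m nz in auto)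
  finally show ?thesis .
qed

lemma op_const_pos: "0 < s \<Longrightarrow> s < 1 \<Longrightarrow> 0 < op_const N s"
  unfolding op_const_def by (intro mult_pos_pos divide_pos_pos Gamma_real_pos) auto

section \<open>Minimum principles\<close>

text \<open>
At a global minimum every value of the integrand \<open>(w x - w y) * op_kernel m s (x - y)\<close> is
nonpositive, and it is negative on \<open>B\<close>.  As the kernel is positive at all distances, the
strict inequality on \<open>B\<close> is felt at \<open>x\<close> however far away \<open>B\<close> lies.
\<close>

lemma strong_maximum_principle_at_minimum:
  fixes w :: "real ^ 'n \<Rightarrow> real"
  assumes s: "0 < s" "s < 1" and m: "0 < m"
    and op: "has_rel_frac_laplacian m s w x v"
    and min: "\<And>y. w x \<le> w y"
    and B: "open B" "B \<noteq> {}" "\<And>y. y \<in> B \<Longrightarrow> w x < w y"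
  shows "v < m powr (2 * s) * w x"
proof -
  let ?g = "\<lambda>y. (w x - w y) * op_kernel m s (x - y)"
  obtain I where I: "has_principal_value ?g x I"
    and v: "v = op_const CARD('n) s * m powr (real CARD('n) / 2 + s) * I + m powr (2 * s) * w x"
    using op unfolding has_rel_frac_laplacian_def by blast
  have neg: "?g y < 0" if "w x < w y" for y
  proof -
    have "x - y \<noteq> 0" using that by auto
    then show ?thesis using that op_kernel_pos[OF s(1) m, of "x - y"] by (simp add: mult_neg_pos)
  qed
  have nonpos: "?g y \<le> 0" for y
    using neg[of y] min[of y] by (cases "w x = w y") auto
  obtain b where b: "b \<in> B" using B by auto
  obtain r where r: "0 < r" "ball b r \<subseteq> B" using B(1) b open_contains_ball by metis
  define d where "d = dist x b"
  have d: "0 < d" using B(3)[OF b] by (auto simp: d_def)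
  \<comment> \<open>a ball inside the set of strict inequality that keeps away from the singularity\<close>
  define A where "A = ball b (min r (d / 2))"
  have A: "A \<in> sets lebesgue" unfolding A_def by auto
  have far: "A \<subseteq> {y. dist x y \<ge> d / 2}"
  proof
    fix y assume "y \<in> A"
    then have "dist b y < d / 2" by (simp add: A_def)
    moreover have "dist x b \<le> dist x y + dist b y" by (metis dist_commute dist_triangle)
    ultimately show "y \<in> {y. dist x y \<ge> d / 2}" by (simp add: d_def)
  qed
  have d2: "0 < d / 2" using d by simp
  note le = principal_value_le_integral[OF I nonpos A d2 far]
  have "(LINT y:A|lebesgue. ?g y) \<noteq> 0"
  proof
    assume 0: "(LINT y:A|lebesgue. ?g y) = 0"
    have "AE y in lebesgue. - (indicator A y *\<^sub>R ?g y) = 0"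
    proof (rule iffD1[OF integral_nonneg_eq_0_iff_AE])
      show "integrable lebesgue (\<lambda>y. - (indicator A y *\<^sub>R ?g y))"
        using le(1) unfolding set_integrable_def by (rule integrable_minus)
      show "AE y in lebesgue. 0 \<le> - (indicator A y *\<^sub>R ?g y)"
        using nonpos by (auto split: split_indicator)
      show "(LINT y|lebesgue. - (indicator A y *\<^sub>R ?g y)) = 0"
        using 0 unfolding set_lebesgue_integral_def by simp
    qed
    then have "AE y in lebesgue. y \<notin> A"
    proof eventually_elim
      case (elim y)
      then show ?case using neg[of y] B(3)[of y] r(2) by (auto simp: A_def split: split_indicator_asm)
    qed
    then have "A \<in> null_sets lebesgue"
      using AE_iff_null_sets[OF A] by blast
    then have "emeasure lborel A = 0" by (simp add: null_sets_def A_def)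
    then have "measure lborel A = 0" by (simp add: measure_def A_def)
    then show False using r d by (simp add: A_def)
  qed
  moreover have "(LINT y:A|lebesgue. ?g y) \<le> 0"
    unfolding set_lebesgue_integral_def
    using Bochner_Integration.integral_nonneg[of lebesgue "\<lambda>y. - (indicator A y *\<^sub>R ?g y)"] nonpos
    by (force split: split_indicator)
  ultimately have "I < 0" using le(2) by linarith
  then show ?thesis
    unfolding v using op_const_pos[OF s] m by (simp add: mult_pos_neg)
qed

text \<open>
At a negative global minimum \<open>x\<close>, each point \<open>y\<close> with \<open>w y \<ge> 0\<close> contributes at most
\<open>w x * op_kernel m s (x - y)\<close> to the operator.  By the size of the kernel, the total contribution
of a ball of small radius \<open>R\<close> around \<open>x\<close> is of order \<open>R powr (- 2 * s) * w x\<close>, which beats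
\<open>L * w x\<close> once \<open>R\<close> is small.  This survives the removal of an exceptional set \<open>N\<close> that occupies at
most a fixed fraction of the ball; only its measure matters, not its shape or position.
\<close>

lemma small_volume_minimum_principle:
  fixes L m s :: real
  assumes s: "0 < s" "s < 1" and m: "0 < m" and L: "0 \<le> L"
  obtains \<delta> where "0 < \<delta>"
    "\<And>(w :: real ^ 'n \<Rightarrow> real) x v N. \<lbrakk>has_rel_frac_laplacian m s w x v; \<And>y. w x \<le> w y; w x < 0;
        N \<in> lmeasurable; measure lebesgue N \<le> \<delta>; \<And>y. y \<notin> N \<Longrightarrow> 0 \<le> w y\<rbrakk> \<Longrightarrow> v < L * w x"
proof -
  define \<nu> where "\<nu> = real CARD('n) / 2 + s"
  define b where "b = unit_ball_vol CARD('n)"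
  have b: "0 < b" by (simp add: b_def)
  define C where "C = op_const CARD('n) s * m powr \<nu>"
  have C: "0 < C" using op_const_pos[OF s] m by (simp add: C_def)
  define c where "c = exp (- exp 1) / 2 * m powr (- \<nu>)"
  have c: "0 < c" using m by (simp add: c_def)
  have "filterlim (\<lambda>R. C * (c * b / 4) * R powr (- (2 * s))) at_top (at_right 0)"
    using s C c b by real_asymp
  then have "\<forall>\<^sub>F R in at_right 0. L < C * (c * b / 4) * R powr (- (2 * s))"
    by (simp add: filterlim_at_top_dense)
  moreover have "\<forall>\<^sub>F R in at_right (0::real). R < 1 / m"
    using eventually_at_rightI[of 0 "1/m" "\<lambda>e. e < 1/m"] m by simp
  moreover have "\<forall>\<^sub>F R in at_right (0::real). 0 < R" by (rule eventually_at_right_less)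
  ultimately have "\<forall>\<^sub>F R in at_right 0. L < C * (c * b / 4) * R powr (- (2 * s)) \<and> R < 1 / m \<and> 0 < R"
    by eventually_elim auto
  then obtain R where R: "L < C * (c * b / 4) * R powr (- (2 * s))" "R < 1 / m" "0 < R"
    using eventually_happens'[of "at_right (0::real)"] by auto
  \<comment> \<open>a quarter of the volume of the ball: half is lost to the inner ball, a quarter to the exceptional set\<close>
  define \<delta> where "\<delta> = b * R ^ CARD('n) / 4"
  define k where "k = c * R powr (- (2 * \<nu>))"
  have k: "0 < k" using c R by (simp add: k_def)
  have "R powr (- (2 * \<nu>)) * R ^ CARD('n) = R powr (- (2 * s))"
    using R(3) by (simp add: \<nu>_def powr_add[symmetric] powr_realpow[symmetric])
  then have Ck: "L < C * (k * \<delta>)" using R(1) by (simp add: k_def \<delta>_def mult_ac)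
  show thesis
  proof
    show "0 < \<delta>" using b R by (simp add: \<delta>_def)
    fix w :: "real ^ 'n \<Rightarrow> real" and x v N
    assume op: "has_rel_frac_laplacian m s w x v" and min: "\<And>y. w x \<le> w y" and neg: "w x < 0"
      and N: "N \<in> lmeasurable" "measure lebesgue N \<le> \<delta>" and pos: "\<And>y. y \<notin> N \<Longrightarrow> 0 \<le> w y"
    let ?g = "\<lambda>y. (w x - w y) * op_kernel m s (x - y)"
    obtain I where I: "has_principal_value ?g x I"
      and v: "v = C * I + m powr (2 * s) * w x"
      using op unfolding has_rel_frac_laplacian_def C_def \<nu>_def by blast
    have nonpos: "?g y \<le> 0" if "y \<noteq> x" for y
      using op_kernel_pos[OF s(1) m, of "x - y"] min[of y] that by (simp add: mult_nonpos_nonneg)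
    \<comment> \<open>the inner ball removes the singularity; in every dimension it has at most half the volume\<close>
    define r where "r = R / 2"
    have r: "0 < r" "r < R" using R by (auto simp: r_def)
    define A where "A = cball x R - ball x r - N"
    have A: "A \<in> lmeasurable" unfolding A_def using N by (intro fmeasurable.Diff) auto
    have far: "A \<subseteq> {y. dist x y \<ge> r}" by (auto simp: A_def)
    note le = principal_value_le_integral[OF I nonpos fmeasurableD[OF A] r(1) far]
    have "(LINT y:A|lebesgue. ?g y) \<le> (LINT y:A|lebesgue. w x * k)"
      using le(1)
    proof (rule set_integral_mono)
      show "set_integrable lebesgue A (\<lambda>y. w x * k)"
        unfolding set_integrable_def using A by (intro integrable_scaleR_left integrable_real_indicator) (auto simp: fmeasurable_def)
      fix y assume y: "y \<in> A"
      then have "x - y \<noteq> 0" "norm (x - y) \<le> R" using r by (auto simp: A_def dist_norm)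
      then have "k \<le> op_kernel m s (x - y)"
        unfolding k_def c_def \<nu>_def using op_kernel_ge[OF s(1) m, of "x - y" R] R m by (simp add: field_simps)
      then have "k * (- w x) \<le> op_kernel m s (x - y) * (w y - w x)"
        using pos[of y] y neg k by (intro mult_mono) (auto simp: A_def)
      then show "?g y \<le> w x * k" by (simp add: algebra_simps)
    qed
    also have "\<dots> = w x * k * measure lebesgue A"
      by (simp add: set_lebesgue_integral_def A fmeasurableD)
    also have "\<dots> \<le> w x * k * \<delta>"
    proof -
      have "ball x r \<subseteq> cball x R" using r by auto
      then have "measure lebesgue (cball x R - ball x r) = b * R ^ CARD('n) - b * r ^ CARD('n)"
        using r by (simp add: measurable_measure_Diff content_cball content_ball b_def)
      moreover have "measure lebesgue (cball x R - ball x r) - measure lebesgue N \<le> measure lebesgue A"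
        unfolding A_def 
        by (rule measure_diff_le_measure_setdiff) (use N in auto)
      moreover have "r ^ CARD('n) \<le> R ^ CARD('n) / 2"
      proof -
        have "(1/2::real) ^ CARD('n) \<le> (1/2) ^ 1" by (rule power_decreasing) (auto simp: Suc_leI)
        then have "R ^ CARD('n) * (1/2::real) ^ CARD('n) \<le> R ^ CARD('n) * (1/2) ^ 1"
          using R by (intro mult_left_mono) auto
        then show ?thesis by (simp add: r_def power_divide)
      qed
      then have "b * r ^ CARD('n) \<le> b * R ^ CARD('n) / 2" using b by simp
      ultimately have "\<delta> \<le> measure lebesgue A" using N(2) by (simp add: \<delta>_def)
      then show ?thesis using neg k by (intro mult_left_mono_neg) (auto simp: mult_nonpos_nonneg)
    qed
    finally have "I \<le> w x * k * \<delta>" using le(2) by linarith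
    then have "C * I \<le> C * (w x * k * \<delta>)" using C by simp
    also have "\<dots> = C * (k * \<delta>) * w x" by simp
    also have "\<dots> < L * w x" using Ck neg by simp
    finally show "v < L * w x"
      unfolding v using neg mult_nonneg_nonpos[of "m powr (2 * s)" "w x"] by simp
  qed
qed

section \<open>Sliding along a fixed direction\<close>

lemma inner_compact_approximation:
  fixes \<Omega> :: "'a::euclidean_space set"
  assumes "open \<Omega>" "bounded \<Omega>" "0 < \<delta>"
  obtains K where "compact K" "K \<subseteq> \<Omega>" "\<Omega> - K \<in> lmeasurable" "measure lebesgue (\<Omega> - K) \<le> \<delta>"
proof -
  obtain K where K: "closed K" "K \<subseteq> \<Omega>" "\<Omega> - K \<in> lmeasurable"
      "emeasure lebesgue (\<Omega> - K) < ennreal \<delta>"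
    using sets_lebesgue_inner_closed[of \<Omega> \<delta>] assms by auto
  moreover have "measure lebesgue (\<Omega> - K) \<le> \<delta>"
    using K assms by (simp add: emeasure_eq_measure2 ennreal_less_iff)
  moreover have "compact K"
    using K assms bounded_subset compact_eq_bounded_closed by blast
  ultimately show thesis using that by blast
qed

text \<open>
The difference \<open>w x = u (x + h) - u x\<close> satisfies an equation with right-hand side bounded by
\<open>L * \<bar>w x\<bar>\<close> wherever both points lie in \<open>\<Omega>\<close>.  If \<open>w\<close> were nonnegative on the points of \<open>K\<close> that \<open>h\<close>
moves into \<open>K\<close>, its negative set would be contained in the union of \<open>\<Omega> - K\<close> and a translate of it,
and its minimum would contradict the small volume principle.  Measuring \<open>\<Omega> - K\<close> instead of a set
depending on \<open>h\<close> makes one compact \<open>K\<close> serve for all shifts at once, which is what allows a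
compactness argument in \<open>h\<close>.
\<close>

lemma negative_shift_meets_compact_core:
  fixes \<Omega> :: "(real ^ 'n) set" and u :: "real ^ 'n \<Rightarrow> real" and f :: "real \<Rightarrow> real"
  assumes s: "0 < s" "s < 1" and m: "0 < m"
    and \<Omega>: "open \<Omega>" "bounded \<Omega>"
    and f: "L-lipschitz_on UNIV f"
    and cont: "continuous_on (closure \<Omega>) u"
    and eq: "\<And>x. x \<in> \<Omega> \<Longrightarrow> has_rel_frac_laplacian m s u x (f (u x))"
  obtains K where "compact K" "K \<subseteq> \<Omega>"
    "\<And>h z. \<lbrakk>\<And>x. x \<notin> \<Omega> \<or> x + h \<notin> \<Omega> \<Longrightarrow> u x \<le> u (x + h); u (z + h) < u z\<rbrakk>
       \<Longrightarrow> \<exists>x\<in>K. x + h \<in> K \<and> u (x + h) < u x"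
proof -
  obtain \<delta> where \<delta>: "0 < \<delta>"
    "\<And>(w :: real ^ 'n \<Rightarrow> real) x v N. \<lbrakk>has_rel_frac_laplacian m s w x v; \<And>y. w x \<le> w y; w x < 0;
        N \<in> lmeasurable; measure lebesgue N \<le> \<delta>; \<And>y. y \<notin> N \<Longrightarrow> 0 \<le> w y\<rbrakk> \<Longrightarrow> v < L * w x"
    using small_volume_minimum_principle[OF s m lipschitz_on_nonneg[OF f]] by blast
  have "0 < \<delta> / 2" using \<delta>(1) by simp
  from inner_compact_approximation[OF \<Omega> this]
  obtain K where K: "compact K" "K \<subseteq> \<Omega>" "\<Omega> - K \<in> lmeasurable" "measure lebesgue (\<Omega> - K) \<le> \<delta> / 2" .
  show thesis
  proof
    fix h z
    assume ext: "\<And>x. x \<notin> \<Omega> \<or> x + h \<notin> \<Omega> \<Longrightarrow> u x \<le> u (x + h)" and z: "u (z + h) < u z"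
    show "\<exists>x\<in>K. x + h \<in> K \<and> u (x + h) < u x"
    proof (rule ccontr)
      assume core: "\<not> ?thesis"
      define w where "w = (\<lambda>x. u (x + h) - u x)"
      define D where "D = \<Omega> \<inter> (\<lambda>x. x + h) -` \<Omega>"
      have D: "open D" "bounded D"
        unfolding D_def using \<Omega>
        by (auto intro!: open_Int continuous_open_vimage continuous_intros intro: bounded_subset)
      have off: "0 \<le> w y" if "y \<notin> D" for y
        using ext[of y] that by (auto simp: D_def w_def)
      have wz: "w z < 0" using z by (simp add: w_def)
      then have zD: "z \<in> D" using off[of z] by force
      have "closure D \<subseteq> closure \<Omega> \<inter> (\<lambda>x. x + h) -` closure \<Omega>"
        by (rule closure_minimal)
           (auto simp: D_def intro!: closed_Int continuous_closed_vimage continuous_intros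
             dest: subsetD[OF closure_subset])
      then have "continuous_on (closure D) w"
        unfolding w_def
        by (intro continuous_on_diff continuous_on_compose2[OF cont] continuous_intros) auto
      moreover have "compact (closure D)" using D by simp
      moreover have "closure D \<noteq> {}" using zD closure_subset by auto
      ultimately obtain x where x: "x \<in> closure D" "\<And>y. y \<in> closure D \<Longrightarrow> w x \<le> w y"
        using continuous_attains_inf[of "closure D" w] by auto
      have "w x \<le> w z" using x(2) zD closure_subset by auto
      then have wx: "w x < 0" using wz by linarith
      then have xD: "x \<in> D" using off[of x] by force
      have min: "w x \<le> w y" for y
        using x(2)[of y] off[of y] wx closure_subset[of D] by force
      define N where "N = D - {x \<in> K. x + h \<in> K}"
      let ?M = "(\<Omega> - K) \<union> (\<lambda>x. x - h) ` (\<Omega> - K)"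
      have "{x \<in> K. x + h \<in> K} = K \<inter> (\<lambda>x. x + h) -` K" by auto
      moreover have "closed \<dots>"
        using K(1) by (intro closed_Int continuous_closed_vimage continuous_intros compact_imp_closed)
      ultimately have N_sets: "N \<in> sets lebesgue"
        unfolding N_def using D(1) by auto
      have sub: "N \<subseteq> ?M"
      proof
        fix y assume "y \<in> N"
        moreover have "y = (y + h) - h" by simp
        ultimately show "y \<in> ?M" unfolding N_def D_def by blast
      qed
      have M: "?M \<in> lmeasurable"
        using K(3) by (intro fmeasurable.Un measurable_translation_subtract)
      have N: "N \<in> lmeasurable" by (rule fmeasurableI2[OF M sub N_sets])
      have "measure lebesgue N \<le> measure lebesgue ?M"
        by (rule measure_mono_fmeasurable[OF sub N_sets M])
      also have "\<dots> \<le> measure lebesgue (\<Omega> - K) + measure lebesgue ((\<lambda>x. x - h) ` (\<Omega> - K))"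
        using K(3) by (intro measure_Un_le fmeasurableD measurable_translation_subtract)
      also have "\<dots> \<le> \<delta>" using K(4) by (simp add: measure_translation_subtract)
      finally have small: "measure lebesgue N \<le> \<delta>" .
      have nonneg: "0 \<le> w y" if "y \<notin> N" for y
        using off[of y] core that by (force simp: N_def w_def)
      have op: "has_rel_frac_laplacian m s w x (f (u (x + h)) - f (u x))"
        unfolding w_def using xD eq
        by (intro has_rel_frac_laplacian_diff has_rel_frac_laplacian_translation[where u=u]) (auto simp: D_def)
      have "f (u (x + h)) - f (u x) < L * w x"
        by (rule \<delta>(2)[OF op min wx N small nonneg])
      moreover have "\<bar>f (u (x + h)) - f (u x)\<bar> \<le> L * \<bar>w x\<bar>"
        using lipschitz_onD[OF f, of "u (x + h)" "u x"] by (simp add: w_def dist_real_def)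
      ultimately show False using wx by simp
    qed
  qed (use K in auto)
qed

text \<open>
At an interior contact point \<open>u (x + h) = u x\<close> the two right-hand sides agree, so the operator
applied to the difference vanishes there, contrary to the strong maximum principle.
\<close>

lemma strict_increase_of_nonneg_shift:
  fixes \<Omega> :: "(real ^ 'n) set" and u :: "real ^ 'n \<Rightarrow> real"
  assumes s: "0 < s" "s < 1" and m: "0 < m"
    and eq: "\<And>x. x \<in> \<Omega> \<Longrightarrow> has_rel_frac_laplacian m s u x (f (u x))"
    and x: "x \<in> \<Omega>" "x + h \<in> \<Omega>"
    and nonneg: "\<And>y. u y \<le> u (y + h)"
    and B: "open B" "B \<noteq> {}" "\<And>y. y \<in> B \<Longrightarrow> u y < u (y + h)"
  shows "u x < u (x + h)"
proof (rule ccontr)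
  assume "\<not> u x < u (x + h)"
  then have 0: "u (x + h) = u x" using nonneg[of x] by simp
  have "has_rel_frac_laplacian m s (\<lambda>y. u (y + h) - u y) x (f (u (x + h)) - f (u x))"
    using x eq by (intro has_rel_frac_laplacian_diff has_rel_frac_laplacian_translation[where u=u])
  then have "f (u (x + h)) - f (u x) < m powr (2 * s) * (u (x + h) - u x)"
    by (rule strong_maximum_principle_at_minimum[OF s m _ _ B(1,2)]) (use 0 nonneg B(3) in auto)
  then show False using 0 by simp
qed

theorem theorem3p11:
  fixes \<Omega> :: "(real ^ 'n) set"
    and u \<phi> :: "real ^ 'n \<Rightarrow> real"
    and f :: "real \<Rightarrow> real"
    and m s :: real
    and k :: 'n
  assumes s: "0 < s" "s < 1"
    and m: "0 < m"
    and domain: "open \<Omega>" "connected \<Omega>" "\<Omega> \<noteq> {}" "bounded \<Omega>"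
    and f_lipschitz: "\<exists>L. L-lipschitz_on UNIV f"
    and u_regular: "u \<in> L_space s" "u \<in> C11_loc \<Omega>" "continuous_on (closure \<Omega>) u"
    and convention: "tail_integrable m s u"
    and equation: "\<And>x. x \<in> \<Omega> \<Longrightarrow> has_rel_frac_laplacian m s u x (f (u x))"
    and exterior: "\<And>x. x \<in> - \<Omega> \<Longrightarrow> u x = \<phi> x"
    and ordering: "\<And>x y z. \<lbrakk>\<And>i. i \<noteq> k \<Longrightarrow> y $ i = x $ i; \<And>i. i \<noteq> k \<Longrightarrow> z $ i = x $ i;
                     y $ k < x $ k; x $ k < z $ k; y \<in> - \<Omega>; z \<in> - \<Omega>\<rbrakk> \<Longrightarrow>
                   (x \<in> \<Omega> \<longrightarrow> \<phi> y < u x \<and> u x < \<phi> z) \<and>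
                   (x \<in> - \<Omega> \<longrightarrow> \<phi> y \<le> \<phi> x \<and> \<phi> x \<le> \<phi> z)"
  shows "\<forall>\<tau>>0. \<forall>x. x \<in> \<Omega> \<longrightarrow> x + \<tau> *\<^sub>R axis k 1 \<in> \<Omega> \<longrightarrow> u (x + \<tau> *\<^sub>R axis k 1) > u x"
proof -
  define e :: "real ^ 'n" where "e = axis k 1"
  have ek: "e $ k = 1" and ei: "\<And>i. i \<noteq> k \<Longrightarrow> e $ i = 0"
    by (auto simp: e_def axis_def)
  have norm_e: "norm e = 1" by (simp add: e_def)
  obtain R where R: "\<And>x. x \<in> \<Omega> \<Longrightarrow> norm x \<le> R"
    using domain(4) bounded_iff by blast
  have far: "x + t *\<^sub>R e \<notin> \<Omega>" if "R < \<bar>x $ k + t\<bar>" for x t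
    using R[of "x + t *\<^sub>R e"] component_le_norm_cart[of "x + t *\<^sub>R e" k] that by (auto simp: ek)
  have order_up: "(x \<in> \<Omega> \<longrightarrow> u x < u (x + \<tau> *\<^sub>R e)) \<and> (x \<notin> \<Omega> \<longrightarrow> u x \<le> u (x + \<tau> *\<^sub>R e))"
    if "0 < \<tau>" "x + \<tau> *\<^sub>R e \<notin> \<Omega>" for x \<tau>
  proof -
    \<comment> \<open>\<open>\<Omega>\<close> is bounded, so the line through \<open>x\<close> leaves it below\<close>
    define y where "y = x + (- (\<bar>R\<bar> + 1 + \<bar>x $ k\<bar>)) *\<^sub>R e"
    have "y \<notin> \<Omega>" unfolding y_def by (rule far) simp
    then show ?thesis
      using ordering[of y x "x + \<tau> *\<^sub>R e"] that exterior by (auto simp: ek ei y_def)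
  qed
  have order_down: "u x < u (x + \<tau> *\<^sub>R e)"
    if "0 < \<tau>" "x \<notin> \<Omega>" "x + \<tau> *\<^sub>R e \<in> \<Omega>" for x \<tau>
  proof -
    \<comment> \<open>likewise the line leaves \<open>\<Omega>\<close> above \<open>x + \<tau> e\<close>\<close>
    define z where "z = x + (\<tau> + \<bar>R\<bar> + 1 + \<bar>x $ k\<bar>) *\<^sub>R e"
    have "z \<notin> \<Omega>" unfolding z_def by (rule far) (use that in simp)
    then show ?thesis
      using ordering[of x "x + \<tau> *\<^sub>R e" z] that exterior by (auto simp: ek ei z_def)
  qed
  have outside: "u x \<le> u (x + \<tau> *\<^sub>R e)" if "0 < \<tau>" "x \<notin> \<Omega> \<or> x + \<tau> *\<^sub>R e \<notin> \<Omega>" for x \<tau>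
    using order_up[of \<tau> x] order_down[of \<tau> x] that by force

  \<comment> \<open>points within \<open>\<tau>\<close> of the top of \<open>\<Omega>\<close> are pushed out of \<open>\<Omega>\<close>\<close>
  have strict_somewhere: "\<exists>B. open B \<and> B \<noteq> {} \<and> (\<forall>y\<in>B. u y < u (y + \<tau> *\<^sub>R e))" if "0 < \<tau>" for \<tau>
  proof -
    define S where "S = Sup ((\<lambda>x. x $ k) ` \<Omega>)"
    have bdd: "bdd_above ((\<lambda>x. x $ k) ` \<Omega>)"
    proof (rule bdd_aboveI2[of _ _ R])
      show "x $ k \<le> R" if "x \<in> \<Omega>" for x
        using R[OF that] component_le_norm_cart[of x k] by linarith
    qed
    define B where "B = \<Omega> \<inter> {x. S - \<tau> < x $ k}"
    have "open B" unfolding B_def by (intro open_Int domain open_halfspace_component_gt_cart[unfolded greaterThan_def])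
    moreover have "\<exists>y\<in>(\<lambda>x. x $ k) ` \<Omega>. S - \<tau> < y"
      using domain(3) bdd that by (subst less_cSup_iff[symmetric]) (auto simp: S_def)
    then have "B \<noteq> {}" by (auto simp: B_def)
    moreover have "u y < u (y + \<tau> *\<^sub>R e)" if y: "y \<in> B" for y
    proof -
      have "y + \<tau> *\<^sub>R e \<notin> \<Omega>"
      proof
        assume "y + \<tau> *\<^sub>R e \<in> \<Omega>"
        then have "(y + \<tau> *\<^sub>R e) $ k \<le> S" unfolding S_def by (intro cSup_upper bdd imageI)
        then show False using y by (simp add: B_def ek)
      qed
      then show ?thesis using order_up[of \<tau> y] y \<open>0 < \<tau>\<close> by (auto simp: B_def)
    qed
    ultimately show ?thesis by blast
  qed
  have strict: "u x < u (x + \<tau> *\<^sub>R e)"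
    if \<tau>: "0 < \<tau>" and x: "x \<in> \<Omega>" "x + \<tau> *\<^sub>R e \<in> \<Omega>" and nonneg: "\<And>y. u y \<le> u (y + \<tau> *\<^sub>R e)" for x \<tau>
    using strict_somewhere[OF \<tau>] strict_increase_of_nonneg_shift[OF s m equation x nonneg] by blast

  obtain L where "L-lipschitz_on UNIV f" using f_lipschitz by blast
  from negative_shift_meets_compact_core[OF s m domain(1,4) this u_regular(3) equation]
  obtain K where K: "compact K" "K \<subseteq> \<Omega>"
    "\<And>h z. \<lbrakk>\<And>x. x \<notin> \<Omega> \<or> x + h \<notin> \<Omega> \<Longrightarrow> u x \<le> u (x + h); u (z + h) < u z\<rbrakk>
       \<Longrightarrow> \<exists>x\<in>K. x + h \<in> K \<and> u (x + h) < u x" by blast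
  have core: "\<exists>x\<in>K. x + \<tau> *\<^sub>R e \<in> K \<and> u (x + \<tau> *\<^sub>R e) < u x"
    if "0 < \<tau>" "u (z + \<tau> *\<^sub>R e) < u z" for \<tau> z
    using K(3)[OF outside[OF that(1)] that(2)] by blast

  have nonneg: "u x \<le> u (x + \<tau> *\<^sub>R e)" if \<tau>: "0 < \<tau>" for x \<tau>
  proof (rule ccontr)
    assume "\<not> ?thesis"
    then obtain x1 where x1: "x1 \<in> K" "x1 + \<tau> *\<^sub>R e \<in> K" "u (x1 + \<tau> *\<^sub>R e) < u x1"
      using core[OF \<tau>, of x] by auto
    have le2R: "t \<le> 2 * R" if "y \<in> K" "y + t *\<^sub>R e \<in> K" for y t
    proof -
      have "norm (t *\<^sub>R e) \<le> norm (y + t *\<^sub>R e) + norm y"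
        using norm_triangle_ineq4[of "y + t *\<^sub>R e" y] by simp
      also have "\<dots> \<le> R + R" using R that K(2) by (intro add_mono) auto
      finally show ?thesis by (simp add: norm_e)
    qed
    define g :: "real \<times> (real ^ 'n) \<Rightarrow> real ^ 'n" where "g = (\<lambda>p. snd p + fst p *\<^sub>R e)"
    have g: "continuous_on A g" for A unfolding g_def by (intro continuous_intros)
    \<comment> \<open>contact points and violations in \<open>K\<close> for all shifts from \<open>\<tau>\<close> on form a compact set \<open>Q\<close>; take the largest shift\<close>
    define P where "P = ({\<tau>..2 * R} \<times> K) \<inter> g -` K"
    have P: "compact P" unfolding P_def
      using K(1) by (intro compact_Int_closed compact_Times closed_vimage compact_imp_closed g) auto
    have uK: "continuous_on K u"
      using u_regular(3) K(2) closure_subset[of \<Omega>] by (blast intro: continuous_on_subset)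
    define Q where "Q = {p \<in> P. u (g p) \<le> u (snd p)}"
    have "continuous_on P (\<lambda>p. u (g p))"
      by (rule continuous_on_compose2[OF uK g]) (auto simp: P_def)
    moreover have "continuous_on P (\<lambda>p. u (snd p))"
      by (rule continuous_on_compose2[OF uK continuous_on_snd[OF continuous_on_id]]) (auto simp: P_def)
    ultimately have "closed Q"
      unfolding Q_def using P by (intro continuous_on_closed_Collect_le compact_imp_closed)
    then have "compact (P \<inter> Q)" using P by (rule compact_Int_closed[rotated])
    moreover have "P \<inter> Q = Q" by (auto simp: Q_def)
    ultimately have "compact Q" by simp
    moreover have inQ: "(t, y) \<in> Q" if "\<tau> \<le> t" "y \<in> K" "y + t *\<^sub>R e \<in> K" "u (y + t *\<^sub>R e) \<le> u y" for t y
      using that le2R by (auto simp: Q_def P_def g_def)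
    then have "Q \<noteq> {}" using x1 by (metis empty_iff less_imp_le order_refl)
    ultimately obtain p where p: "p \<in> Q" "\<And>q. q \<in> Q \<Longrightarrow> fst q \<le> fst p"
      using continuous_attains_sup[of Q fst] continuous_on_fst[OF continuous_on_id] by blast
    obtain \<tau>0 x0 where p_eq: "p = (\<tau>0, x0)" by fastforce
    have 0: "\<tau> \<le> \<tau>0" "x0 \<in> K" "x0 + \<tau>0 *\<^sub>R e \<in> K" "u (x0 + \<tau>0 *\<^sub>R e) \<le> u x0"
      using p(1) by (auto simp: p_eq Q_def P_def g_def)
    then have \<tau>0: "0 < \<tau>0" using \<tau> by linarith
    \<comment> \<open>a violation at \<open>\<tau>0\<close> would persist for slightly larger shifts, against maximality\<close>
    have "u y \<le> u (y + \<tau>0 *\<^sub>R e)" for y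
    proof (rule ccontr)
      assume "\<not> ?thesis"
      then have y: "u (y + \<tau>0 *\<^sub>R e) < u y" by simp
      then have "y + \<tau>0 *\<^sub>R e \<in> \<Omega>" using outside[OF \<tau>0, of y] by force
      then have "isCont u (y + \<tau>0 *\<^sub>R e)"
        using u_regular(3) domain(1) closure_subset[of \<Omega>]
        by (meson continuous_on_eq_continuous_at continuous_on_subset)
      then have "isCont (\<lambda>t. u (y + t *\<^sub>R e)) \<tau>0"
        by (rule isCont_o2[rotated]) (intro continuous_intros)
      then have "((\<lambda>t. u (y + t *\<^sub>R e)) \<longlongrightarrow> u (y + \<tau>0 *\<^sub>R e)) (at_right \<tau>0)"
        unfolding isCont_def by (rule filterlim_mono) (auto simp: at_le)
      then have "\<forall>\<^sub>F t in at_right \<tau>0. u (y + t *\<^sub>R e) < u y \<and> \<tau>0 < t"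
        using y by (intro eventually_conj order_tendstoD(2) eventually_at_right_less)
      then obtain t where t: "u (y + t *\<^sub>R e) < u y" "\<tau>0 < t"
        using eventually_happens'[of "at_right \<tau>0"] by auto
      then obtain x2 where "x2 \<in> K" "x2 + t *\<^sub>R e \<in> K" "u (x2 + t *\<^sub>R e) < u x2"
        using core[of t y] \<tau>0 by auto
      then have "(t, x2) \<in> Q" using inQ[of t x2] t(2) 0(1) by auto
      then show False using p(2) t(2) by (force simp: p_eq)
    qed
    then have "u x0 < u (x0 + \<tau>0 *\<^sub>R e)"
      using strict[OF \<tau>0, of x0] 0 K(2) by blast
    then show False using 0(4) by simp
  qed
  show ?thesis
    using strict nonneg unfolding e_def by blast
qed

end
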